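(* Let $\circ_s\colon[0,\infty]^2\to[0,\infty]$ be such that $a\circ_s b=s(a)$, where $s\colon[0,\infty]\to[0,\infty]$ is an increasing and continuous function with $s(0)=0$, and let $\widehat{s}=s^{-1}$. Then for each scientific record $\mathbf{x}$ we have: (a) $\mathsf{K}_s(\mathbf{x})=\mathrm{Su}^{\circ_{\lfloor\widehat{s}\rfloor}}_{2}(\mathbf{x})$; (b) $\mathsf{K}_s(\mathbf{x})=\big\lfloor\mathrm{Su}^{\circ_{\widehat{s}}}_{2}(\mathbf{x})\big\rfloor=\big\lfloor\widehat{s}\big(\mathrm{Su}_{\circ_s}^{2}(\mathbf{x})\big)\big\rfloor$, where $\lfloor\cdot\rfloor$ is the floor function and $\lfloor\widehat s\rfloor$ denotes the function $a\mapsto\lfloor\widehat s(a)\rfloor$.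
   Context: "Increasing" means strictly increasing, and $s^{-1}$ is the inverse function of $s$; $a\wedge b=\min(a,b)$; $\mathbb{N}=\{1,2,\ldots\}$. A scientific record is a sequence $\mathbf{x}=(x_1,x_2,\ldots)$ with $x_i\in\mathbb{N}\cup\{0\}$, $x_1\ge x_2\ge\ldots$ and $x_1\ge1$. It is identified with the function $i\mapsto x_i$ on $X=\mathbb{N}$. Let $\mu$ be the counting measure on $2^{\mathbb{N}}$ and $Y=[0,\infty]$. The generalized Kosmulski index is $\mathsf{K}_s(\mathbf{x})=\max\{k: x_k\ge s(k)\}$, with $\max\emptyset=0$. For a function $r$ in place of $s$, $\circ_r$ denotes likewise the operation $a\circ_r b=r(a)$. For a binary operation $\circ$ on $[0,\infty]$ that is nondecreasing in each argument and satisfies $0\circ a\le a$ for all $a$, and with $\mathrm{Su}(\mathbf{x})=\sup_{t\in[0,\infty]}\{t\wedge\mu(\{i:x_i\ge t\})\}$ (the Sugeno integral), the upper $2$-Sugeno integral and the lower $2$-Sugeno integral of $\mathbf{x}$ are, respectively, $$\mathrm{Su}^{\circ}_{2}(\mathbf{x})=\sup_{t\in[0,\infty]}\big\{(t\circ\mathrm{Su}(\mathbf{x}))\wedge\mu(\{i:x_i\ge t\})\big\},\qquad \mathrm{Su}_{\circ}^{2}(\mathbf{x})=\sup_{t\in[0,\infty]}\big\{t\wedge\big(\mu(\{i:x_i\ge t\})\circ\mathrm{Su}(\mathbf{x})\big)\big\}.$$ *)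

theory Defs
  imports "HOL-Analysis.Analysis"
begin

text \<open>The indices of a record are the positive integers; the value \<open>x 0\<close> is irrelevant.\<close>

definition scientific_record :: "(nat \<Rightarrow> nat) \<Rightarrow> bool" where
  "scientific_record x \<longleftrightarrow> (\<forall>i j. 1 \<le> i \<longrightarrow> i \<le> j \<longrightarrow> x j \<le> x i) \<and> 1 \<le> x 1"

text \<open>The maximum of a set of natural numbers, with \<open>max {} = 0\<close>. An infinite set gets the
  value \<open>\<infinity>\<close>. For the Kosmulski index of a record this last case is possible only
  if \<open>s \<infinity> < \<infinity>\<close>, see the lemma \<open>finite_Kosmulski_set\<close> below.\<close>

definition max0 :: "nat set \<Rightarrow> ennreal" where
  "max0 A = (if infinite A then \<infinity> else if A = {} then 0 else of_nat (Max A))"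

definition Kosmulski :: "(ennreal \<Rightarrow> ennreal) \<Rightarrow> (nat \<Rightarrow> nat) \<Rightarrow> ennreal" where
  "Kosmulski s x = max0 {k. 1 \<le> k \<and> of_nat (x k) \<ge> s (of_nat k)}"

definition Sugeno :: "'a measure \<Rightarrow> ('a \<Rightarrow> ennreal) \<Rightarrow> ennreal" where
  "Sugeno M f = (SUP t. min t (emeasure M {i \<in> space M. f i \<ge> t}))"

definition upper_Sugeno2 ::
    "(ennreal \<Rightarrow> ennreal \<Rightarrow> ennreal) \<Rightarrow> 'a measure \<Rightarrow> ('a \<Rightarrow> ennreal) \<Rightarrow> ennreal" where
  "upper_Sugeno2 opr M f =
     (SUP t. min (opr t (Sugeno M f)) (emeasure M {i \<in> space M. f i \<ge> t}))"

definition lower_Sugeno2 ::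
    "(ennreal \<Rightarrow> ennreal \<Rightarrow> ennreal) \<Rightarrow> 'a measure \<Rightarrow> ('a \<Rightarrow> ennreal) \<Rightarrow> ennreal" where
  "lower_Sugeno2 opr M f =
     (SUP t. min t (opr (emeasure M {i \<in> space M. f i \<ge> t}) (Sugeno M f)))"

text \<open>The operation \<open>a \<circ>\<^sub>r b = r(a)\<close>. It is also used with \<open>r = inv s\<close>. If
  \<open>s \<infinity> = \<infinity>\<close>, then \<open>s\<close> is a bijection of \<open>[0,\<infinity>]\<close>; otherwise \<open>inv s\<close> is the inverse
  function on \<open>[0, s \<infinity>]\<close> and has unspecified values above \<open>s \<infinity>\<close>. These values do not matter
  in the integrals: for \<open>t > s \<infinity>\<close> the minimum in the upper integral is at most the measure of
  \<open>{i. x i \<ge> s \<infinity>}\<close>, which is the term for \<open>t = s \<infinity>\<close>.\<close>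

definition op_of :: "(ennreal \<Rightarrow> ennreal) \<Rightarrow> ennreal \<Rightarrow> ennreal \<Rightarrow> ennreal" where
  "op_of r a b = r a"

definition efloor :: "ennreal \<Rightarrow> ennreal" where
  "efloor a = (if a = \<infinity> then \<infinity> else ennreal (of_int \<lfloor>enn2real a\<rfloor>))"

abbreviation counting :: "nat measure" where
  "counting \<equiv> count_space {1..}"

text \<open>A record as a function with values in \<open>[0,\<infinity>]\<close>.\<close>

abbreviation record_fun :: "(nat \<Rightarrow> nat) \<Rightarrow> nat \<Rightarrow> ennreal" where
  "record_fun x \<equiv> (\<lambda>i. of_nat (x i))"

lemma finite_Kosmulski_set:
  fixes s :: "ennreal \<Rightarrow> ennreal"
  assumes "continuous_on UNIV s" "s \<infinity> = \<infinity>" "scientific_record x"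
  shows "finite {k. 1 \<le> k \<and> of_nat (x k) \<ge> s (of_nat k)}"
proof -
  have "(\<lambda>n. of_nat n :: ennreal) \<longlonglongrightarrow> \<infinity>"
    using of_nat_tendsto_top_ennreal by simp
  then have "(\<lambda>n. s (of_nat n)) \<longlonglongrightarrow> s \<infinity>"
    by (rule continuous_on_tendsto_compose[OF assms(1)]) auto
  then have "eventually (\<lambda>n. s (of_nat n) > of_nat (x 1)) sequentially"
    by (rule order_tendstoD(1)) (unfold assms(2), simp add: of_nat_less_top)
  then obtain N where N: "\<And>n. n \<ge> N \<Longrightarrow> s (of_nat n) > of_nat (x 1)"
    by (auto simp: eventually_sequentially)
  have "k < N" if "1 \<le> k" "of_nat (x k) \<ge> s (of_nat k)" for k
  proof (rule ccontr)
    assume "\<not> k < N"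
    then have "(of_nat (x 1) :: ennreal) < s (of_nat k)" using N[of k] by simp
    also have "\<dots> \<le> of_nat (x k)" by (rule that)
    also have "\<dots> \<le> of_nat (x 1)"
      using assms(3) that(1) by (auto simp: scientific_record_def)
    finally show False by simp
  qed
  then show ?thesis by (intro finite_subset[OF _ finite_lessThan[of N]]) auto
qed

end

theory Submission imports Defs begin

text \<open>
  Write \<open>\<mu> t\<close> for the number of indices \<open>i \<ge> 1\<close> with \<open>x i \<ge> t\<close>. As \<open>x\<close> is nonincreasing, these
  indices form an initial segment of the positive integers, so that
  \<open>k \<le> \<mu> t \<longleftrightarrow> t \<le> x k\<close> for every integer \<open>k \<ge> 1\<close> (\<open>le_level_measure_iff\<close>); everything about
  records enters through this equivalence. For \<open>t = s k\<close> it says that \<open>k\<close> belongs to the set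
  defining the Kosmulski index \<open>K\<close> exactly when \<open>k \<le> \<mu> (s k)\<close>.

  By the intermediate value theorem, the range of \<open>s\<close> is \<open>[0, s \<infinity>]\<close>, and no \<open>t\<close> above \<open>s \<infinity>\<close>
  contributes to the suprema. Substituting \<open>t = s a\<close> (\<open>SUP_eq_SUP_range\<close>) turns the two upper
  integrals into
  \<open>U = (SUP a. min a (\<mu> (s a)))\<close> for \<open>inv s\<close> and
  \<open>F = (SUP a. min (efloor a) (\<mu> (s a)))\<close> for the floor of \<open>inv s\<close>.
  The first two equalities follow from the cycle \<open>efloor U \<le> K \<le> F \<le> efloor U\<close>:

  \<^item> \<open>efloor U \<le> K\<close>, since an integer \<open>k \<ge> 1\<close> with \<open>k \<le> U\<close> satisfies \<open>s k \<le> x k\<close>. The floor is not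
    continuous from the left, so this is the place where the continuity of \<open>s\<close> is essential:
    if \<open>x k < s k\<close>, then already \<open>x k < s a\<close> for some \<open>a < k\<close>, whence \<open>\<mu> (s a) < k\<close>, and
    \<open>U \<le> max a (\<mu> (s a)) < k\<close> (\<open>Kosmulski_condition_if_le_SUP\<close>).
  \<^item> \<open>K \<le> F\<close>, since an admissible \<open>k\<close> makes the term at \<open>a = k\<close> equal to \<open>k\<close>.
  \<^item> \<open>F \<le> efloor U\<close>, since \<open>\<mu>\<close> takes values in the integers and \<open>\<infinity>\<close>, so that the terms of
    \<open>F\<close> are the floors of those of \<open>U\<close>.

  Finally, \<open>s\<close> is increasing and continuous and hence commutes with suprema and minima, so
  \<open>s U\<close> is the lower integral for \<open>s\<close>. Its image under \<open>inv s\<close> is therefore exactly \<open>U\<close>, even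
  before floors are taken.
\<close>

section \<open>The floor on the extended half-line\<close>

lemma of_nat_le_efloor_iff: "of_nat k \<le> efloor a \<longleftrightarrow> of_nat k \<le> a"
proof (cases a)
  case (real r)
  then show ?thesis
    by (simp add: efloor_def le_floor_iff)
       (metis le_floor_iff of_int_of_nat_eq of_int_le_iff)
qed (simp add: efloor_def)

lemma efloor_cases:
  obtains "efloor a = \<infinity>" "a = \<infinity>" | n where "efloor a = of_nat n"
proof (cases a)
  case (real r)
  then have "efloor a = of_nat (nat \<lfloor>r\<rfloor>)"
    by (simp add: efloor_def ennreal_of_nat_eq_real_of_nat)
  then show ?thesis using that by blast
qed (use that in \<open>auto simp: efloor_def\<close>)

lemma efloor_of_nat [simp]: "efloor (of_nat n) = of_nat n"
  by (simp add: efloor_def ennreal_of_nat_eq_real_of_nat)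

lemma efloor_top [simp]: "efloor top = top"
  by (simp add: efloor_def)

text \<open>The floor of \<open>z\<close> is the supremum of the positive integers below \<open>z\<close>.\<close>

lemma efloor_leI:
  assumes "\<And>k. 1 \<le> k \<Longrightarrow> of_nat k \<le> z \<Longrightarrow> of_nat k \<le> w"
  shows "efloor z \<le> w"
proof (cases z rule: efloor_cases)
  case 1
  have "of_nat k \<le> w" for k
    using assms[of k] 1 by (cases "k = 0") auto
  then have "(SUP k. of_nat k) \<le> w" by (intro SUP_least)
  then show ?thesis by (simp add: ennreal_SUP_of_nat_eq_top top_unique)
next
  case (2 n)
  then show ?thesis
    using assms[of n] of_nat_le_efloor_iff[of n z] by (cases "n = 0") auto
qed

lemma efloor_mono: "a \<le> b \<Longrightarrow> efloor a \<le> efloor b"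
  by (rule efloor_leI) (auto simp: of_nat_le_efloor_iff)

section \<open>The maximum defining the Kosmulski index\<close>

lemma of_nat_le_max0: "k \<in> A \<Longrightarrow> of_nat k \<le> max0 A"
  by (auto simp: max0_def)

text \<open>For an infinite set the bound \<open>w\<close> is infinite, in accordance with \<open>max0 A = \<infinity>\<close>.\<close>

lemma max0_leI:
  assumes "\<And>k. k \<in> A \<Longrightarrow> of_nat k \<le> w"
  shows "max0 A \<le> w"
proof (cases "finite A")
  case True
  then show ?thesis using assms by (auto simp: max0_def)
next
  case False
  have "of_nat n \<le> w" for n
  proof -
    obtain k where "k \<in> A" "n \<le> k"
      using False by (auto simp: infinite_nat_iff_unbounded_le)
    then show ?thesis using assms[of k] by (meson of_nat_mono order_trans)
  qed
  then have "(SUP n. of_nat n) \<le> w" by (intro SUP_least)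
  then show ?thesis by (simp add: ennreal_SUP_of_nat_eq_top top_unique)
qed

section \<open>Level sets of a record\<close>

definition level_measure :: "(nat \<Rightarrow> nat) \<Rightarrow> ennreal \<Rightarrow> ennreal" where
  "level_measure x t = emeasure counting {i \<in> space counting. record_fun x i \<ge> t}"

lemma level_measure_eq:
  "level_measure x t =
     (if finite {i. 1 \<le> i \<and> t \<le> of_nat (x i)} then of_nat (card {i. 1 \<le> i \<and> t \<le> of_nat (x i)})
      else \<infinity>)"
proof -
  have "{i \<in> space counting. record_fun x i \<ge> t} = {i. 1 \<le> i \<and> t \<le> of_nat (x i)}" by auto
  then show ?thesis
    unfolding level_measure_def by (subst emeasure_count_space) auto
qed

lemma antimono_level_measure: "t \<le> t' \<Longrightarrow> level_measure x t' \<le> level_measure x t"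
  unfolding level_measure_def by (rule emeasure_mono) auto

lemma efloor_level_measure: "efloor (level_measure x t) = level_measure x t"
  by (simp add: level_measure_eq)

text \<open>The level set is an initial segment of the positive integers, so it has at least \<open>k\<close>
  elements exactly when it contains \<open>k\<close>.\<close>

lemma le_level_measure_iff:
  assumes "scientific_record x" and k: "1 \<le> k"
  shows "of_nat k \<le> level_measure x t \<longleftrightarrow> t \<le> of_nat (x k)"
proof
  let ?A = "{i. 1 \<le> i \<and> t \<le> of_nat (x i)}"
  have anti: "(of_nat (x j) :: ennreal) \<le> of_nat (x i)" if "1 \<le> i" "i \<le> j" for i j
    using assms(1) that by (simp add: scientific_record_def)
  {
    assume "t \<le> of_nat (x k)"
    then have "{1..k} \<subseteq> ?A" using anti by (auto intro: order_trans)
    then have "k \<le> card ?A" if "finite ?A" using card_mono[OF that, of "{1..k}"] by simp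
    then show "of_nat k \<le> level_measure x t" by (simp add: level_measure_eq)
  next
    assume le: "of_nat k \<le> level_measure x t"
    show "t \<le> of_nat (x k)"
    proof (rule ccontr)
      assume "\<not> t \<le> of_nat (x k)"
      then have "i < k" if "i \<in> ?A" for i
        using anti[OF k, of i] that order_trans[of t "of_nat (x i)"] by (auto simp: not_le[symmetric])
      then have "?A \<subseteq> {1..<k}" by auto
      then have "finite ?A" "card ?A \<le> k - 1"
        using finite_subset card_mono[of "{1..<k}" ?A] by auto
      then show False using le k by (simp add: level_measure_eq)
    qed
  }
qed

section \<open>Substitution in the suprema\<close>

text \<open>The range of \<open>s\<close> is the interval \<open>[0, s \<infinity>]\<close>, and by the hypothesis on \<open>f\<close> nothing
  is lost by leaving out the arguments above it.\<close>

lemma SUP_eq_SUP_range: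
  fixes s :: "ennreal \<Rightarrow> ennreal" and f :: "ennreal \<Rightarrow> 'b :: complete_lattice"
  assumes "continuous_on UNIV s" "s 0 = 0"
    and above: "\<And>t. s \<infinity> \<le> t \<Longrightarrow> f t \<le> f (s \<infinity>)"
  shows "(SUP t. f t) = (SUP a. f (s a))"
proof (rule antisym)
  show "(SUP t. f t) \<le> (SUP a. f (s a))"
  proof (rule SUP_least)
    fix t
    have "\<exists>a. f t \<le> f (s a)"
    proof (cases "t \<le> s \<infinity>")
      case True
      then obtain a where "s a = t"
        using IVT'[of s 0 t \<infinity>] assms by (auto intro: continuous_on_subset)
      then show ?thesis by auto
    next
      case False
      then have "f t \<le> f (s \<infinity>)" by (intro above) simp
      then show ?thesis by blast
    qed
    then show "f t \<le> (SUP a. f (s a))" by (meson SUP_upper2 UNIV_I)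
  qed
qed (auto intro: SUP_least SUP_upper)

text \<open>Above \<open>s \<infinity>\<close> the function \<open>inv s\<close> is arbitrary. The terms there are at most
  \<open>\<mu> (s \<infinity>)\<close>, which is the whole term at \<open>t = s \<infinity>\<close> because \<open>g \<infinity> = \<infinity>\<close>.\<close>

lemma upper_Sugeno2_substitute:
  fixes s g :: "ennreal \<Rightarrow> ennreal"
  assumes "strict_mono s" "continuous_on UNIV s" "s 0 = 0" "g \<infinity> = \<infinity>"
  shows "upper_Sugeno2 (op_of (\<lambda>a. g (inv s a))) counting (record_fun x) =
           (SUP a. min (g a) (level_measure x (s a)))"
proof -
  have inv_s: "inv s (s a) = a" for a
    using assms(1) by (simp add: strict_mono_imp_inj_on)
  have "(SUP t. min (g (inv s t)) (level_measure x t)) =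
        (SUP a. min (g (inv s (s a))) (level_measure x (s a)))"
    using antimono_level_measure assms(4)
    by (intro SUP_eq_SUP_range assms) (auto simp: inv_s min_le_iff_disj)
  then show ?thesis
    unfolding upper_Sugeno2_def op_of_def by (simp add: inv_s level_measure_def)
qed

text \<open>After the substitution \<open>s\<close> is applied to both arguments of each minimum; monotonicity
  moves it in front of the minimum, and left continuity in front of the supremum.\<close>

lemma lower_Sugeno2_eq:
  fixes s :: "ennreal \<Rightarrow> ennreal"
  assumes "strict_mono s" "continuous_on UNIV s" "s 0 = 0"
  shows "lower_Sugeno2 (op_of s) counting (record_fun x) =
           s (SUP a. min a (level_measure x (s a)))"
proof -
  have mono: "mono s" using assms(1) by (rule strict_mono_mono)
  \<comment> \<open>Above \<open>s \<infinity>\<close> the minimum is the second argument, as \<open>s\<close> is bounded by \<open>s \<infinity>\<close>.\<close>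
  have "(SUP t. min t (s (level_measure x t))) =
        (SUP a. min (s a) (s (level_measure x (s a))))"
  proof (rule SUP_eq_SUP_range[OF assms(2,3)])
    fix t
    assume "s \<infinity> \<le> t"
    then have "s (level_measure x t) \<le> s (level_measure x (s \<infinity>))"
      by (intro monoD[OF mono] antimono_level_measure)
    moreover have "s (level_measure x t) \<le> s \<infinity>"
      by (intro monoD[OF mono]) simp
    ultimately show "min t (s (level_measure x t)) \<le> min (s \<infinity>) (s (level_measure x (s \<infinity>)))"
      by (auto simp: min_le_iff_disj)
  qed
  also have "\<dots> = (SUP a. s (min a (level_measure x (s a))))"
    using mono by (simp add: min_of_mono)
  also have "\<dots> = s (SUP a. min a (level_measure x (s a)))"
  proof -
    let ?S = "range (\<lambda>a. min a (level_measure x (s a)))"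
    have "continuous (at_left (Sup ?S)) s"
      using assms(2) by (auto simp: continuous_on_eq_continuous_at
          intro: continuous_within_subset[of _ UNIV])
    then show ?thesis
      using continuous_at_Sup_mono[OF mono, of ?S] by (simp add: image_comp)
  qed
  finally show ?thesis
    unfolding lower_Sugeno2_def op_of_def level_measure_def .
qed

section \<open>Comparison with the Kosmulski index\<close>

text \<open>As a supremum need not be attained, \<open>k \<le> (SUP a. min a (\<mu> (s a)))\<close> gives terms close to
  \<open>k\<close> only. Continuity of \<open>s\<close> closes the gap: were \<open>x k < s k\<close>, a slightly smaller \<open>a < k\<close>
  would still satisfy \<open>x k < s a\<close>, and any such \<open>a\<close> bounds the supremum away from \<open>k\<close>.\<close>

lemma Kosmulski_condition_if_le_SUP:
  fixes s :: "ennreal \<Rightarrow> ennreal"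
  assumes "strict_mono s" "continuous_on UNIV s" "scientific_record x" "1 \<le> k"
    and le: "of_nat k \<le> (SUP a. min a (level_measure x (s a)))"
  shows "s (of_nat k) \<le> of_nat (x k)"
proof (rule ccontr)
  assume "\<not> s (of_nat k) \<le> of_nat (x k)"
  then have "of_nat k \<in> s -` {of_nat (x k)<..}" by auto
  moreover have "open (s -` {of_nat (x k)<..})"
    using assms(2) by (simp add: open_vimage)
  moreover have "0 < (of_nat k :: ennreal)"
    using assms(4) by (simp add: zero_less_iff_neq_zero)
  ultimately obtain b where b: "b < of_nat k" "{b<..of_nat k} \<subseteq> s -` {of_nat (x k)<..}"
    using open_left by blast
  obtain a where "b < a" and a: "a < of_nat k" using dense[OF b(1)] by auto
  then have "a \<in> {b<..of_nat k}" by simp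
  then have "a \<in> s -` {of_nat (x k)<..}" using b(2) by (rule rev_subsetD)
  then have "of_nat (x k) < s a" by simp
  then have \<mu>: "level_measure x (s a) < of_nat k"
    using le_level_measure_iff[OF assms(3,4), of "s a"] by (auto simp: not_le)
  have "(SUP c. min c (level_measure x (s c))) \<le> max a (level_measure x (s a))"
  proof (rule SUP_least)
    fix c
    show "min c (level_measure x (s c)) \<le> max a (level_measure x (s a))"
    proof (cases "c \<le> a")
      case False
      then have "s a \<le> s c" using assms(1) by (simp add: strict_mono_less_eq)
      then show ?thesis
        using antimono_level_measure[of "s a" "s c" x] by (auto simp: min_le_iff_disj le_max_iff_disj)
    qed (auto simp: min_le_iff_disj le_max_iff_disj)
  qed
  also have "\<dots> < of_nat k" using a \<mu> by simp
  finally show False using le by simp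
qed

theorem proposition5p2:
  fixes s :: "ennreal \<Rightarrow> ennreal" and x :: "nat \<Rightarrow> nat"
  assumes "strict_mono s"
    and "continuous_on UNIV s"
    and "s 0 = 0"
    and "scientific_record x"
  shows "Kosmulski s x =
           upper_Sugeno2 (op_of (\<lambda>a. efloor (inv s a))) counting (record_fun x) \<and>
         Kosmulski s x =
           efloor (upper_Sugeno2 (op_of (inv s)) counting (record_fun x)) \<and>
         efloor (upper_Sugeno2 (op_of (inv s)) counting (record_fun x)) =
           efloor (inv s (lower_Sugeno2 (op_of s) counting (record_fun x)))"
proof -
  define U where "U = (SUP a. min a (level_measure x (s a)))"
  define F where "F = (SUP a. min (efloor a) (level_measure x (s a)))"
  have U: "upper_Sugeno2 (op_of (inv s)) counting (record_fun x) = U"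
    using upper_Sugeno2_substitute[OF assms(1-3), of "\<lambda>a. a" x] by (simp add: U_def)
  have F: "upper_Sugeno2 (op_of (\<lambda>a. efloor (inv s a))) counting (record_fun x) = F"
    using upper_Sugeno2_substitute[OF assms(1-3), of efloor x] by (simp add: F_def)
  have "efloor U \<le> Kosmulski s x"
    unfolding Kosmulski_def U_def
    by (intro efloor_leI of_nat_le_max0)
       (use Kosmulski_condition_if_le_SUP[OF assms(1,2,4)] in auto)
  moreover have "Kosmulski s x \<le> F"
    unfolding Kosmulski_def
  proof (rule max0_leI)
    fix k
    assume "k \<in> {k. 1 \<le> k \<and> of_nat (x k) \<ge> s (of_nat k)}"
    then have "of_nat k \<le> min (efloor (of_nat k)) (level_measure x (s (of_nat k)))"
      by (simp add: le_level_measure_iff[OF assms(4)])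
    then show "of_nat k \<le> F" unfolding F_def by (rule SUP_upper2[OF UNIV_I])
  qed
  moreover have "F \<le> efloor U"
    unfolding F_def
  proof (rule SUP_least)
    fix a
    have "min (efloor a) (level_measure x (s a)) = efloor (min a (level_measure x (s a)))"
      using min_of_mono[of efloor a "level_measure x (s a)"]
      by (simp add: efloor_level_measure efloor_mono monoI)
    also have "\<dots> \<le> efloor U" unfolding U_def by (intro efloor_mono SUP_upper) simp
    finally show "min (efloor a) (level_measure x (s a)) \<le> efloor U" .
  qed
  moreover have "inv s (lower_Sugeno2 (op_of s) counting (record_fun x)) = U"
    unfolding lower_Sugeno2_eq[OF assms(1-3)] U_def
    using assms(1) by (simp add: strict_mono_imp_inj_on)
  ultimately show ?thesis unfolding U F by auto
qed

end
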